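(* There exists a constant $c>0$ such that for every positive integer $m$, the number $\mathcal N$ of straight line drawings $\mathbf v$ of $K_{1,2m,2m}$ on $P=\{-2m,-2m+1,\dots,2m-1,2m\}\subset\mathbb Z$ (dimension $d=1$) which minimize $\lambda(\mathbf v)$ satisfies $$c\,\frac{16^m}{m^5}<\mathcal N<16^m.$$
   Context: $K_{1,2m,2m}$ is the complete tripartite graph with classes $A_1,A_2,A_3$ of sizes $1,2m,2m$. A straight line drawing of a graph $G=(V,E)$ with $N=|P|$ vertices on $P$ places the vertices at pairwise distinct points of $P$ (vertex $i$ at $\vec v_i$); for complete multipartite graphs, such a drawing is identified with the coloring of the points of $P$ by the (labelled) classes, so drawings are counted as ordered triples $(A_1,A_2,A_3)$ of disjoint subsets of $P$ of sizes $1,2m,2m$. For a drawing $\mathbf v$, $$\lambda(\mathbf v)=\frac{\sum_{ij\in E}\|\vec v_i-\vec v_j\|^2}{\sum_{i\in V}\|\vec v_i\|^2}.$$ "Minimize" means minimize over all such drawings. *)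

theory Defs
  imports "HOL-Analysis.Analysis"
begin

definition straight_line_drawing ::
  "'v set \<Rightarrow> 'a::euclidean_space set \<Rightarrow> ('v \<Rightarrow> 'a) \<Rightarrow> bool" where
  "straight_line_drawing V P v \<longleftrightarrow> card V = card P \<and> inj_on v V \<and> v ` V \<subseteq> P"

text \<open>
  The edge set \<open>E\<close> of an undirected graph is given as a symmetric set of ordered pairs, so each
  edge \<open>ij\<close> occurs in it twice; hence the factor \<open>1/2\<close>.
\<close>

definition drawing_ratio ::
  "'v set \<Rightarrow> ('v \<times> 'v) set \<Rightarrow> ('v \<Rightarrow> 'a::euclidean_space) \<Rightarrow> real" where
  "drawing_ratio V E v =
     ((1/2) * (\<Sum>(i, j)\<in>E. (norm (v i - v j))\<^sup>2)) / (\<Sum>i\<in>V. (norm (v i))\<^sup>2)"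

text \<open>
  Vertices of \<open>K\<^bsub>n\<^sub>0,\<dots>,n\<^sub>k\<^sub>-\<^sub>1\<^esub>\<close>, with \<open>ns = [n\<^sub>0, \<dots>, n\<^sub>k\<^sub>-\<^sub>1]\<close>, are pairs of a class index and
  a position within that class.
\<close>

definition multipartite_class :: "nat list \<Rightarrow> nat \<Rightarrow> (nat \<times> nat) set" where
  "multipartite_class ns i = {i} \<times> {..<ns ! i}"

definition multipartite_verts :: "nat list \<Rightarrow> (nat \<times> nat) set" where
  "multipartite_verts ns = (\<Union>i<length ns. multipartite_class ns i)"

definition multipartite_edges :: "nat list \<Rightarrow> ((nat \<times> nat) \<times> (nat \<times> nat)) set" where
  "multipartite_edges ns =
     {(x, y). x \<in> multipartite_verts ns \<and> y \<in> multipartite_verts ns \<and> fst x \<noteq> fst y}"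

definition multipartite_drawing_ratio ::
  "nat list \<Rightarrow> (nat \<times> nat \<Rightarrow> 'a::euclidean_space) \<Rightarrow> real" where
  "multipartite_drawing_ratio ns =
     drawing_ratio (multipartite_verts ns) (multipartite_edges ns)"

text \<open>
  Drawings of a complete multipartite graph that differ only by permuting vertices inside the
  classes are identified: a drawing is counted as the tuple of point sets occupied by the
  (labelled) classes.
\<close>

definition drawing_colouring ::
  "nat list \<Rightarrow> (nat \<times> nat \<Rightarrow> 'a) \<Rightarrow> 'a set list" where
  "drawing_colouring ns v = map (\<lambda>i. v ` multipartite_class ns i) [0..<length ns]"

definition minimizing_colourings ::
  "nat list \<Rightarrow> 'a::euclidean_space set \<Rightarrow> 'a set list set" where
  "minimizing_colourings ns P =
     drawing_colouring ns `
       {v. is_arg_min (multipartite_drawing_ratio ns)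
             (straight_line_drawing (multipartite_verts ns) P) v}"

end

(* For points with sum 0 on a line, the identity
     1/2 * (SUM x y : A. |x - y|^2) = |A| * (SUM x : A. |x|^2) - |SUM x : A. x|^2,
   used for all points and for each class, shows that lambda - (2m + 1) is a positive multiple of
   2m a^2 + T1^2 + T2^2, where a is the point of the singleton class and T1, T2 are the sums of the
   other two classes.  So the minimizers are the balanced colourings, with a = T1 = T2 = 0; they
   correspond to the 2m-subsets with sum 0 of the nonzero points, and there are fewer than
   2^(4m) = 16^m of these.  For the lower bound, take X and -Y for m-subsets X, Y of {1..2m} with
   the same sum: there are at most 3 m^2 sums, so by Cauchy-Schwarz at least
   (2m choose m)^2 / (3 m^2) >= 16^m / (12 m^4) such pairs exist. *)
theory Submission
  imports Defs
begin

section \<open>Sums of squared distances in complete multipartite graphs\<close>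

text \<open>Expanding each square, the mixed terms factor by bilinearity into the inner product of
  the total sum with itself. The factor 2 reflects that every unordered pair is met twice.\<close>

lemma sum_norm_diff_squared:
  fixes v :: "'b \<Rightarrow> 'a::real_inner"
  assumes "finite A"
  shows "(\<Sum>x\<in>A. \<Sum>y\<in>A. (norm (v x - v y))\<^sup>2) =
    2 * (real (card A) * (\<Sum>x\<in>A. (norm (v x))\<^sup>2) - (norm (\<Sum>x\<in>A. v x))\<^sup>2)"
proof -
  have "(\<Sum>x\<in>A. \<Sum>y\<in>A. (norm (v x - v y))\<^sup>2) =
      (\<Sum>x\<in>A. \<Sum>y\<in>A. (norm (v x))\<^sup>2 + (norm (v y))\<^sup>2 - 2 * (v x \<bullet> v y))"
    by (simp add: power2_norm_eq_inner inner_diff_left inner_diff_right inner_commute algebra_simps)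
  also have "\<dots> = 2 * (real (card A) * (\<Sum>x\<in>A. (norm (v x))\<^sup>2)) -
      2 * (\<Sum>x\<in>A. \<Sum>y\<in>A. v x \<bullet> v y)"
    by (simp add: sum.distrib sum_subtractf sum_distrib_left algebra_simps)
  also have "(\<Sum>x\<in>A. \<Sum>y\<in>A. v x \<bullet> v y) = (norm (\<Sum>x\<in>A. v x))\<^sup>2"
    unfolding power2_norm_eq_inner inner_sum_left inner_sum_right by (rule sum.swap)
  finally show ?thesis by simp
qed

lemma finite_multipartite_class [simp]: "finite (multipartite_class ns i)"
  by (simp add: multipartite_class_def)

lemma card_multipartite_class [simp]: "card (multipartite_class ns i) = ns ! i"
  by (simp add: multipartite_class_def card_cartesian_product)

lemma finite_multipartite_verts [simp]: "finite (multipartite_verts ns)"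
  by (simp add: multipartite_verts_def)

lemma disjoint_multipartite_class:
  "i \<noteq> j \<Longrightarrow> multipartite_class ns i \<inter> multipartite_class ns j = {}"
  by (auto simp: multipartite_class_def)

lemma sum_multipartite_verts:
  "sum f (multipartite_verts ns) = (\<Sum>i<length ns. sum f (multipartite_class ns i))"
  unfolding multipartite_verts_def
  by (rule sum.UNION_disjoint) (auto simp: disjoint_multipartite_class)

lemma card_multipartite_verts: "card (multipartite_verts ns) = (\<Sum>i<length ns. ns ! i)"
  using sum_multipartite_verts[of "\<lambda>_. 1::nat" ns] by simp

text \<open>The ordered edges are all pairs of vertices minus the pairs inside one class, the
  diagonal being among the latter. The pair identity then applies to the whole vertex set and to
  each class, and its factor 2 cancels against \<open>1/2\<close>.\<close>

lemma sum_multipartite_edges: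
  fixes v :: "nat \<times> nat \<Rightarrow> 'a::real_inner"
  shows "(1/2) * (\<Sum>(x, y)\<in>multipartite_edges ns. (norm (v x - v y))\<^sup>2) =
    real (card (multipartite_verts ns)) * (\<Sum>x\<in>multipartite_verts ns. (norm (v x))\<^sup>2)
      - (norm (\<Sum>x\<in>multipartite_verts ns. v x))\<^sup>2
      - (\<Sum>i<length ns. real (ns ! i) * (\<Sum>x\<in>multipartite_class ns i. (norm (v x))\<^sup>2)
           - (norm (\<Sum>x\<in>multipartite_class ns i. v x))\<^sup>2)"
proof -
  let ?V = "multipartite_verts ns" and ?C = "multipartite_class ns"
  define f where "f = (\<lambda>(x, y). (norm (v x - v y))\<^sup>2)"
  have pairs: "sum f (A \<times> A) =
      2 * (real (card A) * (\<Sum>x\<in>A. (norm (v x))\<^sup>2) - (norm (\<Sum>x\<in>A. v x))\<^sup>2)"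
    if "finite A" for A
    using sum_norm_diff_squared[OF that, of v] by (simp add: f_def sum.cartesian_product)
  let ?D = "\<Union>i<length ns. ?C i \<times> ?C i"
  have E: "multipartite_edges ns = ?V \<times> ?V - ?D"
    by (auto simp: multipartite_edges_def multipartite_verts_def multipartite_class_def)
  have "sum f (multipartite_edges ns) = sum f (?V \<times> ?V) - sum f ?D"
    unfolding E by (rule sum_diff) (auto simp: multipartite_verts_def)
  also have "sum f ?D = (\<Sum>i<length ns. sum f (?C i \<times> ?C i))"
    by (rule sum.UNION_disjoint) (auto simp: multipartite_class_def)
  finally show ?thesis
    by (simp only: pairs f_def[symmetric] finite_multipartite_class finite_multipartite_verts
        card_multipartite_class flip: sum_distrib_left) simp
qed

section \<open>Drawings and colourings\<close>

text \<open>Enumerating each colour class separately and gluing the enumerations yields a drawing.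
  This allows minimizers to be exhibited as partitions of \<open>P\<close> instead of maps.\<close>

lemma drawing_of_colouring:
  assumes len: "length As = length ns"
    and As: "\<And>i. i < length ns \<Longrightarrow> finite (As ! i) \<and> card (As ! i) = ns ! i"
    and disj: "\<And>i j. i < length ns \<Longrightarrow> j < length ns \<Longrightarrow> i \<noteq> j \<Longrightarrow> As ! i \<inter> As ! j = {}"
    and P: "(\<Union>i<length ns. As ! i) = P"
  obtains v where "straight_line_drawing (multipartite_verts ns) P v"
    and "drawing_colouring ns v = As"
proof -
  have "\<exists>g. bij_betw g {..<ns ! i} (As ! i)" if "i < length ns" for i
    using As[OF that] ex_bij_betw_nat_finite[of "As ! i"] by (auto simp: atLeast0LessThan)
  then obtain g where g: "\<And>i. i < length ns \<Longrightarrow> bij_betw (g i) {..<ns ! i} (As ! i)"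
    by metis
  define v where "v = (\<lambda>(i, j). g i j)"
  have im: "v ` multipartite_class ns i = As ! i" if "i < length ns" for i
  proof -
    have "v ` multipartite_class ns i = g i ` {..<ns ! i}"
      by (force simp: v_def multipartite_class_def)
    then show ?thesis using g[OF that] by (simp add: bij_betw_def)
  qed
  have "inj_on v (multipartite_verts ns)"
  proof (rule inj_onI, clarify)
    fix i j i' j'
    assume *: "(i, j) \<in> multipartite_verts ns" "(i', j') \<in> multipartite_verts ns"
      "v (i, j) = v (i', j')"
    then have i: "i < length ns" "i' < length ns" "j < ns ! i" "j' < ns ! i'"
      by (auto simp: multipartite_verts_def multipartite_class_def)
    \<comment> \<open>Disjointness of the colour classes fixes the index \<open>i\<close>;
      injectivity of the enumeration \<open>g i\<close> then fixes the position
      \<open>j\<close>.\<close>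
    have "v (i, j) \<in> As ! i" "v (i', j') \<in> As ! i'"
      using g i by (auto simp: v_def bij_betw_def)
    with *(3) disj[OF i(1,2)] have "i = i'" by auto
    moreover have "j = j'"
      using g[OF i(1)] *(3) i \<open>i = i'\<close> by (auto simp: v_def bij_betw_def dest: inj_onD)
    ultimately show "i = i' \<and> j = j'" by simp
  qed
  moreover have imV: "v ` multipartite_verts ns = P"
    unfolding multipartite_verts_def image_UN using im P by auto
  ultimately have "straight_line_drawing (multipartite_verts ns) P v"
    using card_image[of v "multipartite_verts ns"] by (auto simp: straight_line_drawing_def)
  moreover have "drawing_colouring ns v = As"
    using im len by (auto simp: drawing_colouring_def intro: nth_equalityI)
  ultimately show thesis by (rule that)
qed

text \<open>An injection between finite sets of equal size is onto. Hence a sum over all vertices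
  becomes a sum over \<open>P\<close>, the same for every drawing.\<close>

lemma straight_line_drawing_bij_betw:
  assumes "straight_line_drawing V P v" and "finite P"
  shows "bij_betw v V P"
  using assms card_subset_eq[of P "v ` V"] card_image[of v V]
  by (auto simp: straight_line_drawing_def bij_betw_def)

section \<open>Counting collisions\<close>

text \<open>With \<open>n s\<close> the size of the fibre over \<open>s\<close>, the fibre sizes add
  up to \<open>card F\<close> and their squares to the number of ordered colliding pairs, including
  equal ones. Cauchy-Schwarz compares the two.\<close>

lemma card_squared_le_card_collisions:
  assumes "finite F" "finite S" "f ` F \<subseteq> S"
  shows "(card F)\<^sup>2 \<le> card S * card {(x, y) \<in> F \<times> F. f x = f y}"
proof -
  define n where "n = (\<lambda>s. card {x \<in> F. f x = s})"
  have F: "card F = (\<Sum>s\<in>S. n s)"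
    unfolding n_def
    by (subst card_UN_disjoint[symmetric])
      (use assms in \<open>auto intro!: arg_cong[where f = card]\<close>)
  have "{(x, y) \<in> F \<times> F. f x = f y} = (\<Union>s\<in>S. {x \<in> F. f x = s} \<times> {x \<in> F. f x = s})"
    using assms(3) by auto
  also have "card \<dots> = (\<Sum>s\<in>S. card ({x \<in> F. f x = s} \<times> {x \<in> F. f x = s}))"
    by (rule card_UN_disjoint) (use assms in auto)
  also have "\<dots> = (\<Sum>s\<in>S. (n s)\<^sup>2)"
    by (simp add: n_def card_cartesian_product power2_eq_square)
  finally have C: "card {(x, y) \<in> F \<times> F. f x = f y} = (\<Sum>s\<in>S. (n s)\<^sup>2)" .
  have "(\<Sum>s\<in>S. real (n s))\<^sup>2 \<le> (\<Sum>s\<in>S. (real (n s))\<^sup>2) * real (card S)"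
    by (rule sum_squared_le_sum_of_squares)
  then have "real ((card F)\<^sup>2) \<le> real (card S * card {(x, y) \<in> F \<times> F. f x = f y})"
    unfolding F C by (simp add: mult.commute)
  then show ?thesis by linarith
qed

section \<open>Minimizers and zero-sum subsets\<close>

text \<open>The possible first large classes of a balanced colouring. The second one is the rest of
  the nonzero points, whose sum is then zero as well.\<close>

definition zero_sum_subsets :: "nat \<Rightarrow> real set set" where
  "zero_sum_subsets m =
     {A. A \<subseteq> real_of_int ` {- 2 * int m .. 2 * int m} - {0} \<and> card A = 2 * m \<and> \<Sum>A = 0}"

lemma sum_symmetric_interval: "\<Sum>(real_of_int ` {- k..k}) = 0"
proof -
  have "(\<Sum>x\<in>{- k..k}. real_of_int x) = (\<Sum>x\<in>{- k..k}. - real_of_int x)"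
    by (rule sum.reindex_bij_witness[of _ uminus uminus]) auto
  then show ?thesis by (simp add: sum.reindex inj_on_def sum_negf)
qed

lemma card_symmetric_interval: "card (real_of_int ` {- 2 * int m .. 2 * int m}) = 4 * m + 1"
  by (simp add: card_image inj_on_def)

lemma drawing_ratio_1_2m_2m:
  fixes m :: nat and v :: "nat \<times> nat \<Rightarrow> real"
  defines "P \<equiv> real_of_int ` {- 2 * int m .. 2 * int m}" and "ns \<equiv> [1, 2 * m, 2 * m]"
  assumes "m \<ge> 1" and v: "straight_line_drawing (multipartite_verts ns) P v"
  shows "multipartite_drawing_ratio ns v = 2 * m + 1 +
    (2 * m * (v (0, 0))\<^sup>2 + (\<Sum>x\<in>multipartite_class ns 1. v x)\<^sup>2
      + (\<Sum>x\<in>multipartite_class ns 2. v x)\<^sup>2) / (\<Sum>p\<in>P. p\<^sup>2)"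
    and "(\<Sum>p\<in>P. p\<^sup>2) > 0"
proof -
  let ?V = "multipartite_verts ns" and ?C = "multipartite_class ns"
  have "finite P" by (simp add: P_def)
  then have bij: "bij_betw v ?V P"
    using v by (rule straight_line_drawing_bij_betw[rotated])
  have "1 \<in> P" using \<open>m \<ge> 1\<close> by (force simp: P_def)
  then have "(1::real)\<^sup>2 \<le> (\<Sum>p\<in>P. p\<^sup>2)"
    using \<open>finite P\<close> by (intro member_le_sum) auto
  then show pos: "(\<Sum>p\<in>P. p\<^sup>2) > 0" by simp
  have sq: "(\<Sum>x\<in>?V. (v x)\<^sup>2) = (\<Sum>p\<in>P. p\<^sup>2)"
    using sum.reindex_bij_betw[OF bij, of "\<lambda>p. p\<^sup>2"] .
  have sm: "(\<Sum>x\<in>?V. v x) = 0"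
    using sum.reindex_bij_betw[OF bij, of "\<lambda>p. p"] sum_symmetric_interval[of "2 * int m"]
    by (simp add: P_def)
  have len: "{..<length ns} = {0, 1, 2}" by (auto simp: ns_def)
  have C0: "?C 0 = {(0, 0)}" by (auto simp: multipartite_class_def ns_def)
  have card: "card ?V = 4 * m + 1"
    by (simp add: card_multipartite_verts len) (simp add: ns_def)
  have split: "(\<Sum>p\<in>P. p\<^sup>2) = (v (0, 0))\<^sup>2 + (\<Sum>x\<in>?C 1. (v x)\<^sup>2) + (\<Sum>x\<in>?C 2. (v x)\<^sup>2)"
    using sum_multipartite_verts[of "\<lambda>x. (v x)\<^sup>2" ns] by (simp add: sq len C0)
  have "(1/2) * (\<Sum>(x, y)\<in>multipartite_edges ns. (norm (v x - v y))\<^sup>2) =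
      (4 * m + 1) * (\<Sum>p\<in>P. p\<^sup>2)
      - (2 * m * (\<Sum>x\<in>?C 1. (v x)\<^sup>2) - (\<Sum>x\<in>?C 1. v x)\<^sup>2
       + (2 * m * (\<Sum>x\<in>?C 2. (v x)\<^sup>2) - (\<Sum>x\<in>?C 2. v x)\<^sup>2))"
    unfolding sum_multipartite_edges by (simp add: sq sm len C0 card) (simp add: ns_def)
  \<comment> \<open>By \<open>split\<close>, the squares in the two large classes add up to the full
    sum minus the square at the single vertex. This lowers the coefficient from
    \<open>4 * m + 1\<close> to \<open>2 * m + 1\<close> and leaves \<open>2 * m\<close> times that
    square.\<close>
  also have "\<dots> = (2 * m + 1) * (\<Sum>p\<in>P. p\<^sup>2) +
      (2 * m * (v (0, 0))\<^sup>2 + (\<Sum>x\<in>?C 1. v x)\<^sup>2 + (\<Sum>x\<in>?C 2. v x)\<^sup>2)"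
    unfolding split by (simp add: algebra_simps)
  finally have "multipartite_drawing_ratio ns v = ((2 * m + 1) * (\<Sum>p\<in>P. p\<^sup>2) +
      (2 * m * (v (0, 0))\<^sup>2 + (\<Sum>x\<in>?C 1. v x)\<^sup>2 + (\<Sum>x\<in>?C 2. v x)\<^sup>2)) / (\<Sum>p\<in>P. p\<^sup>2)"
    by (simp only: multipartite_drawing_ratio_def drawing_ratio_def sq real_norm_def power2_abs)
  then show "multipartite_drawing_ratio ns v = 2 * m + 1 +
    (2 * m * (v (0, 0))\<^sup>2 + (\<Sum>x\<in>?C 1. v x)\<^sup>2 + (\<Sum>x\<in>?C 2. v x)\<^sup>2) / (\<Sum>p\<in>P. p\<^sup>2)"
    using pos by (simp add: add_divide_distrib)
qed

text \<open>The nonzero integers from \<open>-m\<close> to \<open>m\<close> serve as witness. It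
  shows that the value \<open>2 * m + 1\<close> of the ratio is attained.\<close>

lemma zero_sum_subsets_nonempty: "zero_sum_subsets m \<noteq> {}"
proof -
  let ?A = "real_of_int ` {- int m..int m} - {0}"
  have "card ?A = 2 * m"
    by (subst card_Diff_singleton) (force simp: card_image inj_on_def)+
  moreover have "\<Sum>?A = 0"
    using sum_symmetric_interval[of "int m"] by (simp add: sum_diff1)
  ultimately have "?A \<in> zero_sum_subsets m"
    by (auto simp: zero_sum_subsets_def)
  then show ?thesis by blast
qed

lemma minimizing_colourings_1_2m_2m:
  fixes m :: nat
  defines "P \<equiv> real_of_int ` {- 2 * int m .. 2 * int m}" and "ns \<equiv> [1, 2 * m, 2 * m]"
  assumes m: "m \<ge> 1"
  shows "minimizing_colourings ns P = (\<lambda>A. [{0}, A, P - {0} - A]) ` zero_sum_subsets m"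
proof -
  let ?V = "multipartite_verts ns" and ?C = "multipartite_class ns"
  let ?drawing = "straight_line_drawing ?V P"
  define T where "T i v = (\<Sum>x\<in>?C i. v x)" for i and v :: "nat \<times> nat \<Rightarrow> real"
  \<comment> \<open>The excess of the ratio over \<open>2 * m + 1\<close>, up to the constant
    positive denominator. As a sum of squares with positive weights it vanishes only for balanced
    drawings.\<close>
  define q where "q v = 2 * m * (v (0, 0))\<^sup>2 + (T 1 v)\<^sup>2 + (T 2 v)\<^sup>2"
    for v :: "nat \<times> nat \<Rightarrow> real"
  have ratio: "multipartite_drawing_ratio ns v = 2 * m + 1 + q v / (\<Sum>p\<in>P. p\<^sup>2)"
    and pos: "(\<Sum>p\<in>P. p\<^sup>2) > 0" if "?drawing v" for v
    using drawing_ratio_1_2m_2m[OF m that[unfolded P_def ns_def]]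
    by (simp_all add: P_def ns_def q_def T_def)
  have q_nonneg: "q v \<ge> 0" for v by (simp add: q_def)
  have q_0: "q v = 0 \<longleftrightarrow> v (0, 0) = 0 \<and> T 1 v = 0 \<and> T 2 v = 0" for v
    using m by (auto simp: q_def add_nonneg_eq_0_iff)
  have finP: "finite P" by (simp add: P_def)
  have C0: "?C 0 = {(0, 0)}" by (auto simp: multipartite_class_def ns_def)
  have col: "drawing_colouring ns v = [{v (0, 0)}, v ` ?C 1, v ` ?C 2]" for v :: "nat \<times> nat \<Rightarrow> real"
    using C0 by (simp add: drawing_colouring_def ns_def numeral_2_eq_2)
  have V: "?V = insert (0, 0) (?C 1 \<union> ?C 2)"
    using C0 by (simp add: multipartite_verts_def ns_def lessThan_Suc numeral_2_eq_2 Un_commute)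
  have T_image: "\<Sum>(v ` ?C i) = T i v" and card_image_C: "card (v ` ?C i) = ns ! i"
    if "?drawing v" "i = 1 \<or> i = 2" for v i
  proof -
    have "inj_on v (?C i)"
      using that by (auto simp: straight_line_drawing_def V intro: inj_on_subset)
    then show "\<Sum>(v ` ?C i) = T i v" "card (v ` ?C i) = ns ! i"
      by (simp_all add: sum.reindex T_def card_image)
  qed
  have balanced: "\<exists>v. ?drawing v \<and> drawing_colouring ns v = [{0}, A, P - {0} - A] \<and> q v = 0"
    if A: "A \<in> zero_sum_subsets m" for A
  proof -
    have A': "A \<subseteq> P - {0}" "card A = 2 * m" "\<Sum>A = 0"
      using A by (auto simp: zero_sum_subsets_def P_def)
    have "finite A" using A'(1) finP by (meson finite_Diff finite_subset)
    have "0 \<in> P" by (force simp: P_def)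
    have cB: "card (P - {0} - A) = 2 * m"
      using A' \<open>0 \<in> P\<close> \<open>finite A\<close> card_symmetric_interval[of m, folded P_def]
      by (simp add: card_Diff_subset)
    \<comment> \<open>All of \<open>P\<close> sums to zero by symmetry, so removing \<open>0\<close>
      and the zero-sum set \<open>A\<close> leaves sum zero.\<close>
    have sB: "\<Sum>(P - {0} - A) = 0"
      using A' finP sum_symmetric_interval[of "2 * int m"]
      by (simp add: sum_diff sum_diff1 P_def)
    obtain v where v: "?drawing v" "drawing_colouring ns v = [{0}, A, P - {0} - A]"
    proof (rule drawing_of_colouring[of "[{0}, A, P - {0} - A]" ns P])
      show "length [{0}, A, P - {0} - A] = length ns" by (simp add: ns_def)
      show "(\<Union>i<length ns. [{0}, A, P - {0} - A] ! i) = P"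
        using A' \<open>0 \<in> P\<close> by (auto simp: ns_def lessThan_Suc)
    next
      fix i assume "i < length ns"
      then show "finite ([{0}, A, P - {0} - A] ! i) \<and> card ([{0}, A, P - {0} - A] ! i) = ns ! i"
        using A' \<open>finite A\<close> finP cB by (auto simp: ns_def less_Suc_eq)
    next
      fix i j assume "i < length ns" "j < length ns" "i \<noteq> j"
      then show "[{0}, A, P - {0} - A] ! i \<inter> [{0}, A, P - {0} - A] ! j = {}"
        using A' by (auto simp: ns_def less_Suc_eq)
    qed
    have "v (0, 0) = 0" "v ` ?C 1 = A" "v ` ?C 2 = P - {0} - A"
      using v(2) by (simp_all add: col)
    then have "q v = 0"
      using T_image[OF v(1), of 1] T_image[OF v(1), of 2] A' sB by (simp add: q_0)
    with v show ?thesis by blast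
  qed
  \<comment> \<open>Some drawing \<open>w\<close> has \<open>q w = 0\<close>, so the minimum of the
    ratio is exactly \<open>2 * m + 1\<close>, and minimizing means that \<open>q\<close>
    vanishes.\<close>
  have arg_min: "is_arg_min (multipartite_drawing_ratio ns) ?drawing v \<longleftrightarrow> ?drawing v \<and> q v = 0"
    for v
  proof -
    obtain w where w: "?drawing w" "q w = 0"
      using zero_sum_subsets_nonempty balanced by blast
    show ?thesis
    proof
      assume v: "is_arg_min (multipartite_drawing_ratio ns) ?drawing v"
      then have d: "?drawing v" by (simp add: is_arg_min_def)
      have "\<not> multipartite_drawing_ratio ns w < multipartite_drawing_ratio ns v"
        using v w(1) by (auto simp: is_arg_min_def)
      then have "\<not> 0 < q v / (\<Sum>p\<in>P. p\<^sup>2)"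
        using ratio[OF d] ratio[OF w(1)] w(2) by simp
      then have "q v = 0"
        using pos[OF d] q_nonneg[of v] by (simp add: zero_less_divide_iff)
      with d show "?drawing v \<and> q v = 0" by simp
    next
      assume v: "?drawing v \<and> q v = 0"
      have "\<not> multipartite_drawing_ratio ns y < multipartite_drawing_ratio ns v"
        if y: "?drawing y" for y
        using v ratio[of v] ratio[OF y] pos[OF y] q_nonneg[of y] by (simp add: not_less)
      then show "is_arg_min (multipartite_drawing_ratio ns) ?drawing v"
        using v by (auto simp: is_arg_min_def)
    qed
  qed
  show ?thesis
  proof (rule equalityI; rule subsetI)
    fix L assume "L \<in> minimizing_colourings ns P"
    then obtain v where v: "?drawing v" "q v = 0" "L = drawing_colouring ns v"
      by (auto simp: minimizing_colourings_def arg_min)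
    have bij: "bij_betw v ?V P"
      using v(1) finP by (rule straight_line_drawing_bij_betw)
    then have inj: "inj_on v ?V" and im: "v ` ?V = P"
      by (auto simp: bij_betw_def)
    have v0: "v (0, 0) = 0" using v(2) by (simp add: q_0)
    have disj: "v ` ?C 1 \<inter> v ` ?C 2 = {}"
      using inj disjoint_multipartite_class[of 1 2 ns]
      by (subst inj_on_image_Int[OF inj, symmetric]) (auto simp: V)
    have "(0, 0) \<notin> ?C 1" "(0, 0) \<notin> ?C 2"
      by (auto simp: multipartite_class_def)
    then have "v (0, 0) \<notin> v ` ?C 1" "v (0, 0) \<notin> v ` ?C 2"
      using inj unfolding V by (auto simp: inj_on_def)
    then have nz: "0 \<notin> v ` ?C 1" "0 \<notin> v ` ?C 2"
      unfolding v0 .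
    have P: "P = insert 0 (v ` ?C 1 \<union> v ` ?C 2)"
      using im unfolding V by (simp add: v0 image_Un)
    have "v ` ?C 1 \<in> zero_sum_subsets m"
      using T_image[OF v(1), of 1] card_image_C[OF v(1), of 1] v(2) P nz
      unfolding zero_sum_subsets_def P_def[symmetric] by (auto simp: q_0 ns_def)
    moreover have "L = [{0}, v ` ?C 1, P - {0} - v ` ?C 1]"
    proof -
      have "v ` ?C 2 = P - {0} - v ` ?C 1"
        using P nz disj by blast
      then show ?thesis by (simp add: v(3) col v0)
    qed
    ultimately show "L \<in> (\<lambda>A. [{0}, A, P - {0} - A]) ` zero_sum_subsets m" by blast
  next
    fix L assume "L \<in> (\<lambda>A. [{0}, A, P - {0} - A]) ` zero_sum_subsets m"
    then obtain A where "A \<in> zero_sum_subsets m" and L: "L = [{0}, A, P - {0} - A]" by blast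
    then obtain v where "?drawing v" "drawing_colouring ns v = L" "q v = 0"
      using balanced by blast
    then show "L \<in> minimizing_colourings ns P"
      unfolding minimizing_colourings_def arg_min by blast
  qed
qed

section \<open>Bounds for the number of zero-sum subsets\<close>

lemma finite_zero_sum_subsets: "finite (zero_sum_subsets m)"
  unfolding zero_sum_subsets_def
  by (rule finite_subset[of _ "Pow (real_of_int ` {- 2 * int m .. 2 * int m})"]) auto

lemma card_zero_sum_subsets_less:
  assumes "m \<ge> 1"
  shows "card (zero_sum_subsets m) < 16 ^ m"
proof -
  let ?Q = "real_of_int ` {- 2 * int m .. 2 * int m} - {0}"
  have "0 \<in> real_of_int ` {- 2 * int m .. 2 * int m}" by force
  then have "card ?Q = 4 * m + 1 - 1"
    unfolding card_symmetric_interval[symmetric] by (rule card_Diff_singleton)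
  then have "card ?Q = 4 * m" by (simp only: add_diff_cancel_right')
  \<comment> \<open>The empty set has the wrong size, which makes the inclusion in the power set,
    and with it the upper bound, strict.\<close>
  have "{} \<notin> zero_sum_subsets m"
    using assms by (simp add: zero_sum_subsets_def)
  then have "zero_sum_subsets m \<subset> Pow ?Q"
    unfolding zero_sum_subsets_def by blast
  then have "card (zero_sum_subsets m) < card (Pow ?Q)"
    by (intro psubset_card_mono) auto
  also have "\<dots> = 2 ^ (4 * m)"
    unfolding \<open>card ?Q = 4 * m\<close>[symmetric] by (rule card_Pow) simp
  also have "\<dots> = 16 ^ m"
    by (simp add: power_mult)
  finally show ?thesis .
qed

text \<open>The collision bound for the map sending an \<open>m\<close>-subset to its sum bounds
  \<open>card D\<close> from below, and \<open>h\<close> embeds \<open>D\<close> into the zero-sum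
  subsets by joining \<open>X\<close> with the reflection of \<open>Y\<close>.\<close>

lemma card_zero_sum_subsets_ge:
  assumes m: "m \<ge> 1"
  shows "(2 * m choose m)\<^sup>2 \<le> 3 * m\<^sup>2 * card (zero_sum_subsets m)"
proof -
  define F where "F = {X. X \<subseteq> {1..2 * int m} \<and> card X = m}"
  define D where "D = {(X, Y) \<in> F \<times> F. \<Sum>X = \<Sum>Y}"
  define h where "h = (\<lambda>(X, Y). real_of_int ` (X \<union> uminus ` Y))"
  have finF: "finite F" unfolding F_def by simp
  have cF: "card F = (2 * m choose m)"
    unfolding F_def using n_subsets[of "{1..2 * int m}" m] by (simp add: nat_mult_distrib)
  \<comment> \<open>There are \<open>m\<close> elements, each at most \<open>2 * m\<close>. The
    resulting \<open>2 * m^2 + 1\<close> possible sums number at most \<open>3 * m^2\<close> because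
    \<open>m \<ge> 1\<close>.\<close>
  have "\<Sum>X \<in> {0..2 * (int m)\<^sup>2}" if "X \<in> F" for X
  proof -
    have X: "X \<subseteq> {1..2 * int m}" "card X = m" using that by (auto simp: F_def)
    have "\<Sum>X \<le> of_nat (card X) * (2 * int m)"
      using X by (intro sum_bounded_above) auto
    moreover have "\<Sum>X \<ge> 0" using X by (intro sum_nonneg) force
    ultimately show ?thesis using X by (simp add: power2_eq_square)
  qed
  then have "(card F)\<^sup>2 \<le> card {0..2 * (int m)\<^sup>2} * card D"
    unfolding D_def using finF by (intro card_squared_le_card_collisions) auto
  also have "card {0..2 * (int m)\<^sup>2} \<le> 3 * m\<^sup>2"
    using m by (simp add: nat_add_distrib nat_mult_distrib nat_power_eq)
  finally have 1: "(2 * m choose m)\<^sup>2 \<le> 3 * m\<^sup>2 * card D" by (simp add: cF)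
  have "inj_on h D"
  proof (rule inj_onI, clarify)
    fix X Y X' Y' assume a: "(X, Y) \<in> D" "(X', Y') \<in> D" "h (X, Y) = h (X', Y')"
    then have U: "X \<union> uminus ` Y = X' \<union> uminus ` Y'"
      by (simp add: h_def inj_image_eq_iff inj_on_def)
    \<comment> \<open>Both sets consist of positive integers, so the positive part of the union
      recovers \<open>X\<close> and the negative part recovers \<open>Y\<close>.\<close>
    have rec: "X = (X \<union> uminus ` Y) \<inter> {0<..}" "Y = uminus ` ((X \<union> uminus ` Y) \<inter> {..<0})"
      if "(X, Y) \<in> D" for X Y
    proof -
      have "X \<subseteq> {0<..}" "Y \<subseteq> {0<..}" using that by (force simp: D_def F_def)+
      then show "X = (X \<union> uminus ` Y) \<inter> {0<..}" by force
      have "(X \<union> uminus ` Y) \<inter> {..<0} = uminus ` Y"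
        using \<open>X \<subseteq> {0<..}\<close> \<open>Y \<subseteq> {0<..}\<close> by force
      then show "Y = uminus ` ((X \<union> uminus ` Y) \<inter> {..<0})" by (simp add: image_image)
    qed
    show "X = X' \<and> Y = Y'"
      using rec[OF a(1)] rec[OF a(2)] U by metis
  qed
  moreover have "h ` D \<subseteq> zero_sum_subsets m"
  proof (clarify)
    fix X Y assume "(X, Y) \<in> D"
    then have X: "X \<subseteq> {1..2 * int m}" "card X = m" and Y: "Y \<subseteq> {1..2 * int m}" "card Y = m"
      and eq: "\<Sum>X = \<Sum>Y"
      by (auto simp: D_def F_def)
    have fin: "finite X" "finite Y" using X Y finite_subset by auto
    have disj: "X \<inter> uminus ` Y = {}" using X Y by force
    have "card (X \<union> uminus ` Y) = 2 * m"
      using fin disj X Y by (simp add: card_Un_disjoint card_image)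
    moreover have "\<Sum>(X \<union> uminus ` Y) = 0"
      using fin disj eq by (simp add: sum.union_disjoint sum.reindex sum_negf)
    moreover have "X \<union> uminus ` Y \<subseteq> {- 2 * int m..2 * int m} - {0}"
      using X Y by force
    moreover have "inj_on real_of_int (X \<union> uminus ` Y)" by (simp add: inj_on_def)
    then have "card (h (X, Y)) = card (X \<union> uminus ` Y)"
      and "\<Sum>(h (X, Y)) = real_of_int (\<Sum>(X \<union> uminus ` Y))"
      by (simp_all only: h_def prod.case card_image sum.reindex of_int_sum comp_def)
    ultimately show "h (X, Y) \<in> zero_sum_subsets m"
      by (auto simp: zero_sum_subsets_def h_def)
  qed
  ultimately have "card D \<le> card (zero_sum_subsets m)"
    using finite_zero_sum_subsets by (rule card_inj_on_le)
  with 1 show ?thesis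
    by (meson le_trans mult_le_mono2)
qed

theorem proposition3:
  shows "\<exists>c::real. c > 0 \<and>
    (\<forall>m::nat. m \<ge> 1 \<longrightarrow>
      (let P = real_of_int ` {- 2 * int m .. 2 * int m};
           \<N> = card (minimizing_colourings [1, 2 * m, 2 * m] P)
       in c * (16 ^ m / real m ^ 5) < real \<N> \<and> \<N> < 16 ^ m))"
proof (intro exI[of _ "1/13"] conjI allI impI)
  fix m :: nat assume m: "m \<ge> 1"
  define N where
    "N = card (minimizing_colourings [1, 2 * m, 2 * m] (real_of_int ` {- 2 * int m .. 2 * int m}))"
  \<comment> \<open>A colouring has \<open>A\<close> as its second entry, so distinct zero-sum
    subsets give distinct colourings.\<close>
  have N: "N = card (zero_sum_subsets m)"
    unfolding N_def minimizing_colourings_1_2m_2m[OF m] by (rule card_image) (auto intro: inj_onI)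
  have "(4 ^ m / (2 * real m))\<^sup>2 \<le> (real (2 * m choose m))\<^sup>2"
    using central_binomial_lower_bound[of m] m by (intro power_mono) auto
  also have "\<dots> \<le> 3 * (real m)\<^sup>2 * real N"
    using card_zero_sum_subsets_ge[OF m] unfolding N
    by (metis (mono_tags) of_nat_le_iff of_nat_mult of_nat_numeral of_nat_power)
  finally have "((4::real) ^ m)\<^sup>2 / (4 * (real m)\<^sup>2) \<le> 3 * (real m)\<^sup>2 * real N"
    by (simp add: power_divide power_mult_distrib)
  moreover have "((4::real) ^ m)\<^sup>2 = 16 ^ m"
    by (simp add: power2_eq_square flip: power_mult_distrib)
  ultimately have "16 ^ m \<le> 12 * real m ^ 4 * real N"
    using m by (simp add: field_simps power2_eq_square power4_eq_xxxx)
  \<comment> \<open>The argument gives order \<open>16^m / m^4\<close>; since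
    \<open>m \<ge> 1\<close>, the exponent may be raised to 5.\<close>
  also have "\<dots> \<le> 12 * real m ^ 5 * real N"
    using m by (intro mult_right_mono mult_left_mono power_increasing) auto
  \<comment> \<open>The 12 is the product of 3, from the number of sums, and 4, from squaring
    \<open>4^m / (2 * m)\<close>. Passing to 13 makes the inequality strict, as \<open>N\<close> is
    positive.\<close>
  also have "\<dots> < 13 * real m ^ 5 * real N"
  proof -
    have "N > 0"
      unfolding N using zero_sum_subsets_nonempty finite_zero_sum_subsets by (simp add: card_gt_0_iff)
    then show ?thesis using m by simp
  qed
  finally have "1/13 * (16 ^ m / real m ^ 5) < real N"
    using m by (simp add: field_simps)
  moreover have "N < 16 ^ m"
    unfolding N by (rule card_zero_sum_subsets_less[OF m])
  ultimately show "let P = real_of_int ` {- 2 * int m .. 2 * int m};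
      \<N> = card (minimizing_colourings [1, 2 * m, 2 * m] P)
    in 1/13 * (16 ^ m / real m ^ 5) < real \<N> \<and> \<N> < 16 ^ m"
    by (simp add: Let_def N_def)
qed simp

end
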